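(* There exists a Lipschitz function $F:(\mathbb Z\wr\mathbb Z)_0\to L_2$ which cannot be extended to a Lipschitz function from $\mathbb Z\wr\mathbb Z$ to $L_2$.
   Context: The (restricted) wreath product $\mathbb Z\wr\mathbb Z$ is the group of all pairs $(f,x)$ where $x\in\mathbb Z$ and $f:\mathbb Z\to\mathbb Z$ has finite support, with product $(f,x)(g,y)=\left(z\mapsto f(z)+g(z-x),\,x+y\right)$. It is equipped with the left-invariant word metric $d_{\mathbb Z\wr\mathbb Z}$ associated with the generators $(\mathbf 0,\pm1)$ and $(\pm\mathbf 1_{\{0\}},0)$. The zero section $(\mathbb Z\wr\mathbb Z)_0=\{(f,x)\in\mathbb Z\wr\mathbb Z:\ x=0\}$ carries the metric inherited from $d_{\mathbb Z\wr\mathbb Z}$. $L_2=L_2([0,1])$. *)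

theory Defs
  imports "HOL-Analysis.Analysis"
begin

section \<open>The wreath product of the integers with the integers\<close>

text \<open>The group law is written additively, although it is not commutative: the type classes
  for not necessarily commutative groups use additive notation.\<close>

typedef zwrz = "{(f, x). finite {z. f z \<noteq> 0}} :: ((int \<Rightarrow> int) \<times> int) set"
  by (rule exI[of _ "(\<lambda>_. 0, 0)"]) simp

setup_lifting type_definition_zwrz

lift_definition lamps :: "zwrz \<Rightarrow> int \<Rightarrow> int" is fst .

lift_definition pos :: "zwrz \<Rightarrow> int" is snd .

lemma zwrz_eqI: "lamps g = lamps h \<Longrightarrow> pos g = pos h \<Longrightarrow> g = h"
  by transfer (auto simp: prod_eq_iff)

lemma finite_lamps: "finite {z. lamps g z \<noteq> 0}"
  by transfer auto

lemma finite_support_shift: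
  fixes g :: "int \<Rightarrow> int"
  assumes "finite {z. g z \<noteq> 0}"
  shows "finite {z. g (z + x) \<noteq> 0}"
proof -
  have "{z. g (z + x) \<noteq> 0} \<subseteq> (\<lambda>z. z - x) ` {z. g z \<noteq> 0}"
  proof
    fix z assume "z \<in> {z. g (z + x) \<noteq> 0}"
    then have "z = (z + x) - x" "z + x \<in> {z. g z \<noteq> 0}" by auto
    then show "z \<in> (\<lambda>z. z - x) ` {z. g z \<noteq> 0}" by (rule image_eqI)
  qed
  then show ?thesis using assms finite_surj by blast
qed

instantiation zwrz :: group_add
begin

lift_definition zero_zwrz :: zwrz is "(\<lambda>_. 0, 0)" by simp

lift_definition plus_zwrz :: "zwrz \<Rightarrow> zwrz \<Rightarrow> zwrz"
  is "\<lambda>(f, x) (g, y). (\<lambda>z. f z + g (z - x), x + y)"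
proof clarsimp
  fix f g :: "int \<Rightarrow> int" and x :: int
  assume f: "finite {z. f z \<noteq> 0}" and g: "finite {z. g z \<noteq> 0}"
  have "{z. f z + g (z - x) \<noteq> 0} \<subseteq> {z. f z \<noteq> 0} \<union> {z. g (z + - x) \<noteq> 0}" by auto
  then show "finite {z. f z + g (z - x) \<noteq> 0}"
    using f finite_support_shift[OF g, of "- x"] finite_subset by blast
qed

lift_definition uminus_zwrz :: "zwrz \<Rightarrow> zwrz"
  is "\<lambda>(f, x). (\<lambda>z. - f (z + x), - x)"
  by (auto intro: finite_support_shift)

definition minus_zwrz :: "zwrz \<Rightarrow> zwrz \<Rightarrow> zwrz" where
  "minus_zwrz g h = g + - h"

instance
proof
  fix a b c :: zwrz
  show "a + b + c = a + (b + c)"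
    by transfer (auto simp: algebra_simps)
  show "0 + a = a" by transfer auto
  show "a + 0 = a" by transfer auto
  show "- a + a = 0" by transfer auto
  show "a + - b = a - b" by (simp add: minus_zwrz_def)
qed

end

lemma lamps_simps [simp]:
  "lamps 0 z = 0"
  "lamps (g + h) z = lamps g z + lamps h (z - pos g)"
  "lamps (- g) z = - lamps g (z + pos g)"
  by (transfer, auto)+

lemma pos_simps [simp]:
  "pos 0 = 0"
  "pos (g + h) = pos g + pos h"
  "pos (- g) = - pos g"
  by (transfer, auto)+

lift_definition shift :: "int \<Rightarrow> zwrz" is "\<lambda>x. (\<lambda>_. 0, x)" by simp

lift_definition lamp :: "int \<Rightarrow> zwrz" is "\<lambda>k. (\<lambda>z. if z = 0 then k else 0, 0)" by simp

definition generators :: "zwrz set" where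
  "generators = {shift 1, shift (- 1), lamp 1, lamp (- 1)}"

definition word_length :: "zwrz \<Rightarrow> nat" where
  "word_length g = (LEAST n. \<exists>ws. set ws \<subseteq> generators \<and> length ws = n \<and> sum_list ws = g)"

lemma lamps_shift [simp]: "lamps (shift x) z = 0" by transfer simp
lemma pos_shift [simp]: "pos (shift x) = x" by transfer simp
lemma lamps_lamp [simp]: "lamps (lamp k) z = (if z = 0 then k else 0)" by transfer simp
lemma pos_lamp [simp]: "pos (lamp k) = 0" by transfer simp

lemma uminus_generators: "g \<in> generators \<Longrightarrow> - g \<in> generators"
proof -
  have "- shift x = shift (- x)" "- lamp x = lamp (- x)" for x
    by (intro zwrz_eqI ext; simp)+
  then show "g \<in> generators \<Longrightarrow> - g \<in> generators"
    by (auto simp: generators_def)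
qed

lemma sum_list_uminus_rev: "sum_list (rev (map uminus ws)) = - sum_list (ws :: zwrz list)"
  by (induction ws) (simp_all add: minus_add)

lemma ex_word: "\<exists>ws. set ws \<subseteq> generators \<and> sum_list ws = g"
proof -
  define S where "S = {g. \<exists>ws. set ws \<subseteq> generators \<and> sum_list ws = g}"
  have zero: "0 \<in> S"
    unfolding S_def by (auto intro: exI[of _ "[]"])
  have gen: "a \<in> S" if "a \<in> generators" for a
    unfolding S_def using that by (auto intro: exI[of _ "[a]"])
  have add: "a + b \<in> S" if ab: "a \<in> S" "b \<in> S" for a b
  proof -
    obtain v w where "set v \<subseteq> generators" "sum_list v = a" "set w \<subseteq> generators" "sum_list w = b"
      using ab unfolding S_def by blast
    then have "set (v @ w) \<subseteq> generators \<and> sum_list (v @ w) = a + b" by simp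
    then show ?thesis unfolding S_def by blast
  qed
  have neg: "- a \<in> S" if a: "a \<in> S" for a
  proof -
    obtain v where "set v \<subseteq> generators" "sum_list v = a"
      using a unfolding S_def by blast
    then have "set (rev (map uminus v)) \<subseteq> generators \<and> sum_list (rev (map uminus v)) = - a"
      using uminus_generators sum_list_uminus_rev[of v] by auto
    then show ?thesis unfolding S_def by blast
  qed
  have shift_nat: "shift (int n) \<in> S" for n
  proof (induction n)
    case 0
    have "shift 0 = 0" by (intro zwrz_eqI ext; simp)
    then show ?case using zero by simp
  next
    case (Suc n)
    have "shift (int (Suc n)) = shift 1 + shift (int n)" by (intro zwrz_eqI ext; simp)
    then show ?case using Suc add gen by (simp add: generators_def)
  qed
  have shift: "shift x \<in> S" for x
  proof (cases x rule: int_cases2)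
    case (nonneg n)
    then show ?thesis using shift_nat by simp
  next
    case (nonpos n)
    have "shift (- int n) = - shift (int n)" by (intro zwrz_eqI ext; simp)
    then show ?thesis using shift_nat neg nonpos by simp
  qed
  have lamp_nat: "lamp (int n) \<in> S" for n
  proof (induction n)
    case 0
    have "lamp 0 = 0" by (intro zwrz_eqI ext; simp)
    then show ?case using zero by simp
  next
    case (Suc n)
    have "lamp (int (Suc n)) = lamp 1 + lamp (int n)" by (intro zwrz_eqI ext; simp)
    then show ?case using Suc add gen by (simp add: generators_def)
  qed
  have lamp: "lamp x \<in> S" for x
  proof (cases x rule: int_cases2)
    case (nonneg n)
    then show ?thesis using lamp_nat by simp
  next
    case (nonpos n)
    have "lamp (- int n) = - lamp (int n)" by (intro zwrz_eqI ext; simp)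
    then show ?thesis using lamp_nat neg nonpos by simp
  qed
  have "g \<in> S" if "finite A" "{z. lamps g z \<noteq> 0} \<subseteq> A" "pos g = 0" for A g
    using that
  proof (induction A arbitrary: g rule: finite_induct)
    case empty
    then have "g = 0" by (intro zwrz_eqI ext; auto)
    then show ?case using zero by simp
  next
    case (insert y A)
    define p where "p = shift y + (lamp (lamps g y) + shift (- y))"
    have p: "p \<in> S" unfolding p_def by (intro add shift lamp)
    have lp: "lamps p z = (if z = y then lamps g y else 0)" for z by (simp add: p_def)
    have pp: "pos p = 0" by (simp add: p_def)
    have "lamps (- p + g) z = (if z = y then 0 else lamps g z)" for z
      by (simp add: lp pp)
    then have "{z. lamps (- p + g) z \<noteq> 0} \<subseteq> A" using insert.prems(1) by auto
    then have "- p + g \<in> S" using insert.IH[of "- p + g"] insert.prems(2) pp by simp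
    then have "p + (- p + g) \<in> S" using p add by blast
    then show ?case by (simp add: add.assoc[symmetric])
  qed
  then have flat: "g + shift (- pos g) \<in> S"
    using finite_lamps[of "g + shift (- pos g)"] by (metis add.right_inverse order_refl pos_shift pos_simps(2))
  have "g = (g + shift (- pos g)) + shift (pos g)" by (intro zwrz_eqI ext; simp)
  then have "g \<in> S" using add flat shift by metis
  then show ?thesis unfolding S_def by blast
qed

lemma word_length_word:
  "\<exists>ws. set ws \<subseteq> generators \<and> length ws = word_length g \<and> sum_list ws = g"
  unfolding word_length_def
  by (rule LeastI_ex) (use ex_word[of g] in blast)

lemma word_length_le: "set ws \<subseteq> generators \<Longrightarrow> word_length (sum_list ws) \<le> length ws"
  unfolding word_length_def by (rule Least_le) blast

lemma word_length_eq_0_iff [simp]: "word_length g = 0 \<longleftrightarrow> g = 0"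
  using word_length_word[of g] word_length_le[of "[]"] by auto

lemma word_length_add_le: "word_length (g + h) \<le> word_length g + word_length h"
proof -
  obtain v where v: "set v \<subseteq> generators" "length v = word_length g" "sum_list v = g"
    using word_length_word by blast
  obtain w where w: "set w \<subseteq> generators" "length w = word_length h" "sum_list w = h"
    using word_length_word by blast
  show ?thesis using word_length_le[of "v @ w"] v w by simp
qed

lemma word_length_uminus [simp]: "word_length (- g) = word_length g"
proof -
  have le: "word_length (- g) \<le> word_length g" for g
  proof -
    obtain v where v: "set v \<subseteq> generators" "length v = word_length g" "sum_list v = g"
      using word_length_word by blast
    then have "set (rev (map uminus v)) \<subseteq> generators" using uminus_generators by auto
    from word_length_le[OF this] show ?thesis using v by (simp only: sum_list_uminus_rev) simp
  qed
  show ?thesis using le[of g] le[of "- g"] by simp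
qed

instantiation zwrz :: metric_space
begin

definition dist_zwrz :: "zwrz \<Rightarrow> zwrz \<Rightarrow> real" where
  "dist_zwrz g h = real (word_length (- g + h))"

definition uniformity_zwrz :: "(zwrz \<times> zwrz) filter" where
  "uniformity_zwrz = (INF e\<in>{0<..}. principal {(x, y). dist x y < e})"

definition open_zwrz :: "zwrz set \<Rightarrow> bool" where
  "open_zwrz U = (\<forall>x\<in>U. eventually (\<lambda>(x', y). x' = x \<longrightarrow> y \<in> U) uniformity)"

instance
proof
  fix a b c :: zwrz
  show "dist a b = 0 \<longleftrightarrow> a = b"
    by (auto simp: dist_zwrz_def neg_eq_iff_add_eq_0[symmetric])
  have "- a + b = (- a + c) + - (- b + c)"
    by (simp add: minus_add add.assoc)
  then show "dist a b \<le> dist a c + dist b c"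
    unfolding dist_zwrz_def
    by (metis of_nat_add of_nat_mono word_length_add_le word_length_uminus)
qed (simp_all add: uniformity_zwrz_def open_zwrz_def)

end

text \<open>The zero section; as a subset of the metric space \<open>zwrz\<close> it carries the restriction
  of the word metric of the whole group, not an intrinsic one.\<close>

definition zero_section :: "zwrz set" where
  "zero_section = {g. pos g = 0}"


section \<open>The space \<open>L\<^sub>2([0,1])\<close>\<close>

definition square_integrable :: "(real \<Rightarrow> real) \<Rightarrow> bool" where
  "square_integrable f \<longleftrightarrow> f \<in> borel_measurable (lebesgue_on {0..1}) \<and>
     integrable (lebesgue_on {0..1}) (\<lambda>t. (f t)\<^sup>2)"

definition L2_rel :: "(real \<Rightarrow> real) \<Rightarrow> (real \<Rightarrow> real) \<Rightarrow> bool" where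
  "L2_rel f g \<longleftrightarrow> square_integrable f \<and> square_integrable g \<and>
     (AE t in lebesgue_on {0..1}. f t = g t)"

lemma L2_rel_part_equivp: "part_equivp L2_rel"
proof (rule part_equivpI)
  show "\<exists>f. L2_rel f f"
    by (rule exI[of _ "\<lambda>_. 0"]) (simp add: L2_rel_def square_integrable_def)
  show "symp L2_rel"
    by (auto simp: symp_def L2_rel_def)
  show "transp L2_rel"
    unfolding transp_def L2_rel_def by (auto elim: eventually_elim2)
qed

quotient_type L2 = "real \<Rightarrow> real" / partial: L2_rel
  by (rule L2_rel_part_equivp)

lemma square_integrable_diff:
  assumes "square_integrable f" "square_integrable g"
  shows "square_integrable (\<lambda>t. f t - g t)"
proof -
  have [measurable]: "f \<in> borel_measurable (lebesgue_on {0..1})"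
    "g \<in> borel_measurable (lebesgue_on {0..1})"
    using assms by (auto simp: square_integrable_def)
  have int: "integrable (lebesgue_on {0..1}) (\<lambda>t. 2 * (f t)\<^sup>2 + 2 * (g t)\<^sup>2)"
    using assms by (auto simp: square_integrable_def)
  have le: "(f t - g t)\<^sup>2 \<le> 2 * (f t)\<^sup>2 + 2 * (g t)\<^sup>2" for t
    using zero_le_power2[of "f t + g t"] by (simp add: power2_eq_square algebra_simps)
  have "integrable (lebesgue_on {0..1}) (\<lambda>t. (f t - g t)\<^sup>2)"
    by (rule Bochner_Integration.integrable_bound[OF int]) (use le in auto)
  then show ?thesis by (simp add: square_integrable_def)
qed

lemma L2_minkowski:
  assumes f: "square_integrable f" and g: "square_integrable g"
  shows "sqrt (LINT t|lebesgue_on {0..1}. (f t - g t)\<^sup>2)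
    \<le> sqrt (LINT t|lebesgue_on {0..1}. (f t)\<^sup>2) + sqrt (LINT t|lebesgue_on {0..1}. (g t)\<^sup>2)"
    (is "sqrt ?I \<le> sqrt ?P + sqrt ?Q")
proof (rule field_le_epsilon)
  fix e :: real assume e: "0 < e"
  define p where "p = sqrt ?P + e / 2"
  define q where "q = sqrt ?Q + e / 2"
  have P: "0 \<le> ?P" and Q: "0 \<le> ?Q" by simp_all
  have p: "0 < p" "?P \<le> p\<^sup>2"
    using e P unfolding p_def by (auto intro: add_nonneg_pos simp: power2_sum)
  have q: "0 < q" "?Q \<le> q\<^sup>2"
    using e Q unfolding q_def by (auto intro: add_nonneg_pos simp: power2_sum)
  have intf: "integrable (lebesgue_on {0..1}) (\<lambda>t. (f t)\<^sup>2)"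
    and intg: "integrable (lebesgue_on {0..1}) (\<lambda>t. (g t)\<^sup>2)"
    and intfg: "integrable (lebesgue_on {0..1}) (\<lambda>t. (f t - g t)\<^sup>2)"
    using f g square_integrable_diff[OF f g] by (auto simp: square_integrable_def)
  have pw: "(f t - g t)\<^sup>2 \<le> (1 + q / p) * (f t)\<^sup>2 + (1 + p / q) * (g t)\<^sup>2" for t
  proof -
    have "(1 + q / p) * (f t)\<^sup>2 + (1 + p / q) * (g t)\<^sup>2 - (f t - g t)\<^sup>2
        = (q * f t + p * g t)\<^sup>2 / (p * q)"
      using p q by (simp add: field_simps power2_eq_square)
    then show ?thesis using p q by (smt (verit) divide_nonneg_pos mult_pos_pos zero_le_power2)
  qed
  have "?I \<le> (LINT t|lebesgue_on {0..1}. (1 + q / p) * (f t)\<^sup>2 + (1 + p / q) * (g t)\<^sup>2)"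
    by (rule integral_mono[OF intfg]) (use intf intg pw in auto)
  also have "\<dots> = (1 + q / p) * ?P + (1 + p / q) * ?Q"
    using intf intg by simp
  also have "\<dots> \<le> (1 + q / p) * p\<^sup>2 + (1 + p / q) * q\<^sup>2"
    using p q by (intro add_mono mult_left_mono) auto
  also have "\<dots> = (p + q)\<^sup>2"
    using p q by (simp add: field_simps power2_eq_square)
  finally have "sqrt ?I \<le> p + q"
    using p q by (simp add: real_le_lsqrt)
  then show "sqrt ?I \<le> sqrt ?P + sqrt ?Q + e" by (simp add: p_def q_def)
qed

instantiation L2 :: metric_space
begin

lift_definition dist_L2 :: "L2 \<Rightarrow> L2 \<Rightarrow> real"
  is "\<lambda>f g. sqrt (LINT t|lebesgue_on {0..1}. (f t - g t)\<^sup>2)"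
proof -
  fix f f' g g' :: "real \<Rightarrow> real"
  assume R: "L2_rel f f'" "L2_rel g g'"
  then have [measurable]: "f \<in> borel_measurable (lebesgue_on {0..1})"
    "g \<in> borel_measurable (lebesgue_on {0..1})" "f' \<in> borel_measurable (lebesgue_on {0..1})"
    "g' \<in> borel_measurable (lebesgue_on {0..1})"
    by (auto simp: L2_rel_def square_integrable_def)
  have "AE t in lebesgue_on {0..1}. f t = f' t" "AE t in lebesgue_on {0..1}. g t = g' t"
    using R by (auto simp: L2_rel_def)
  then have "AE t in lebesgue_on {0..1}. (f t - g t)\<^sup>2 = (f' t - g' t)\<^sup>2"
    by eventually_elim simp
  then have "(LINT t|lebesgue_on {0..1}. (f t - g t)\<^sup>2)
      = (LINT t|lebesgue_on {0..1}. (f' t - g' t)\<^sup>2)"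
    by (intro integral_cong_AE) simp_all
  then show "sqrt (LINT t|lebesgue_on {0..1}. (f t - g t)\<^sup>2)
      = sqrt (LINT t|lebesgue_on {0..1}. (f' t - g' t)\<^sup>2)"
    by simp
qed

definition uniformity_L2 :: "(L2 \<times> L2) filter" where
  "uniformity_L2 = (INF e\<in>{0<..}. principal {(x, y). dist x y < e})"

definition open_L2 :: "L2 set \<Rightarrow> bool" where
  "open_L2 U = (\<forall>x\<in>U. eventually (\<lambda>(x', y). x' = x \<longrightarrow> y \<in> U) uniformity)"

instance
proof
  fix a b c :: L2
  show "dist a b = 0 \<longleftrightarrow> a = b"
  proof transfer
    fix f g assume fg: "L2_rel f f" "L2_rel g g"
    then have "integrable (lebesgue_on {0..1}) (\<lambda>t. (f t - g t)\<^sup>2)"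
      using square_integrable_diff[of f g] by (simp add: L2_rel_def square_integrable_def)
    then show "sqrt (LINT t|lebesgue_on {0..1}. (f t - g t)\<^sup>2) = 0 \<longleftrightarrow> L2_rel f g"
      using fg by (simp add: integral_nonneg_eq_0_iff_AE L2_rel_def)
  qed
  show "dist a b \<le> dist a c + dist b c"
  proof transfer
    fix f g h assume "L2_rel f f" "L2_rel g g" "L2_rel h h"
    then have "square_integrable (\<lambda>t. f t - h t)" "square_integrable (\<lambda>t. g t - h t)"
      by (auto simp: L2_rel_def intro: square_integrable_diff)
    from L2_minkowski[OF this]
    show "sqrt (LINT t|lebesgue_on {0..1}. (f t - g t)\<^sup>2)
      \<le> sqrt (LINT t|lebesgue_on {0..1}. (f t - h t)\<^sup>2)
        + sqrt (LINT t|lebesgue_on {0..1}. (g t - h t)\<^sup>2)"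
      by simp
  qed
qed (simp_all add: uniformity_L2_def open_L2_def)

end

end

theory Submission
  imports Defs
begin

text \<open>The map sends a lamp configuration to its family of staircases, the one at site \<open>z\<close> being
  weighted by \<open>sqrt \<bar>z\<bar>\<close>, so that two points \<open>g\<close>, \<open>h\<close> of the zero section have images at squared
  distance \<open>\<Sum>z. \<bar>z\<bar> * \<bar>g z - h z\<bar>\<close>. A word leading from \<open>g\<close> to \<open>h\<close> has to reach every site where they
  differ and to spend a letter on every unit of difference, so both the largest such \<open>\<bar>z\<bar>\<close> and
  the total difference are at most the distance of \<open>g\<close> and \<open>h\<close>; the map is therefore 1-Lipschitz
  (\<open>lipschitz_staircase_map\<close>).

  Suppose that \<open>G\<close> is a \<open>C\<close>-Lipschitz extension. Restrict it to the points whose lamps stand at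
  \<open>0\<close> or \<open>k\<close> on the sites \<open>1, \<dots>, m\<close> and vanish elsewhere, with the lamplighter at some \<open>x \<le> m\<close>.
  For each \<open>x\<close> this is a function on the cube \<open>{0,k}^m\<close>; let \<open>u z x\<close> be its mean increment when
  lamp \<open>z\<close> is switched from \<open>0\<close> to \<open>k\<close>, that is, up to a factor, its first-order Walsh coefficient
  at \<open>z\<close>. Three facts about these vectors are incompatible.

  \<^item> On the zero section the increments do not depend on the other lamps, so
    \<open>\<parallel>u z 0\<parallel>\<^sup>2 = z * k\<close>.
  \<^item> With the lamplighter standing at the lamp, switching costs only \<open>k\<close> letters, so
    \<open>\<parallel>u z z\<parallel> \<le> C * k\<close>.
  \<^item> Moving the lamplighter by one step changes \<open>G\<close> by at most \<open>C\<close>. By Bessel's inequality, all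
    \<open>m\<close> coefficients of that change together obey the bound that a single one would obey:
    \<open>\<Sum>z. \<parallel>u z (x + 1) - u z x\<parallel>\<^sup>2 \<le> 4 * C\<^sup>2\<close>.

  Going from \<open>u z z\<close> to \<open>u z 0\<close> in \<open>z \<le> m\<close> steps and summing over \<open>z\<close>, one gets
  \<open>m\<^sup>2 * k \<le> const * C\<^sup>2 * (m * k\<^sup>2 + m\<^sup>2)\<close>, which fails for \<open>m = k\<^sup>2\<close> and \<open>k\<close> large. All these estimates are
  inequalities between sums of squares of differences, so they are proved for real-valued
  functions (\<open>cube_path_inequality\<close>) and then integrated over \<open>[0,1]\<close> (\<open>no_lipschitz_extension\<close>).\<close>

section \<open>First-order Walsh coefficients on the discrete cube\<close>

text \<open>Subsets of \<open>Z\<close> are the vertices of a cube. This is the Walsh coefficient without the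
  normalising factor.\<close>

definition walsh_coeff :: "'a set \<Rightarrow> 'a \<Rightarrow> ('a set \<Rightarrow> real) \<Rightarrow> real" where
  "walsh_coeff Z z h = (\<Sum>A\<in>Pow (Z - {z}). h (insert z A) - h A)"

lemma walsh_coeff_diff: "walsh_coeff Z z (\<lambda>A. g A - h A) = walsh_coeff Z z g - walsh_coeff Z z h"
  unfolding walsh_coeff_def sum_subtractf[symmetric] by (intro sum.cong refl) simp

lemma sum_Pow_insert:
  fixes h :: "'a set \<Rightarrow> real"
  assumes "finite Z" "w \<notin> Z"
  shows "(\<Sum>A\<in>Pow (insert w Z). h A) = (\<Sum>A\<in>Pow Z. h A + h (insert w A))"
proof -
  have "inj_on (insert w) (Pow Z)"
    using assms by (auto simp: inj_on_def)
  moreover have "Pow Z \<inter> insert w ` Pow Z = {}"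
    using assms by auto
  ultimately show ?thesis
    using assms by (simp add: Pow_insert sum.union_disjoint sum.reindex sum.distrib)
qed

text \<open>Bessel's inequality, since the coefficients are inner products of \<open>h\<close> with the orthogonal
  system of characters \<open>A \<mapsto> \<plusminus>1\<close>, each of squared norm \<open>2 ^ card Z\<close>. In the induction, adding a
  coordinate \<open>w\<close> splits the cube into two halves: the old coefficients only see the sum of \<open>h\<close> over
  the halves and the new one only sees the difference, so the parallelogram law adds up the two
  bounds.\<close>

lemma bessel_walsh_coeff:
  assumes "finite Z"
  shows "(\<Sum>z\<in>Z. (walsh_coeff Z z h)\<^sup>2) \<le> 2 ^ card Z * (\<Sum>A\<in>Pow Z. (h A)\<^sup>2)"
  using assms
proof (induction Z arbitrary: h rule: finite_induct)
  case empty
  then show ?case by simp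
next
  case (insert w Z)
  define s where "s A = h A + h (insert w A)" for A
  define d where "d A = h (insert w A) - h A" for A
  have old: "walsh_coeff (insert w Z) z h = walsh_coeff Z z s" if z: "z \<in> Z" for z
  proof -
    have "insert w Z - {z} = insert w (Z - {z})" using z insert.hyps by auto
    then have "walsh_coeff (insert w Z) z h
        = (\<Sum>A\<in>Pow (insert w (Z - {z})). h (insert z A) - h A)"
      by (simp add: walsh_coeff_def)
    also have "\<dots> = walsh_coeff Z z s"
      using insert.hyps
      by (subst sum_Pow_insert) (auto simp: walsh_coeff_def s_def insert_commute intro!: sum.cong)
    finally show ?thesis .
  qed
  have new: "walsh_coeff (insert w Z) w h = (\<Sum>A\<in>Pow Z. d A)"
    using insert.hyps by (simp add: walsh_coeff_def d_def)
  have "(\<Sum>z\<in>insert w Z. (walsh_coeff (insert w Z) z h)\<^sup>2)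
      = (\<Sum>A\<in>Pow Z. d A)\<^sup>2 + (\<Sum>z\<in>Z. (walsh_coeff Z z s)\<^sup>2)"
    using insert.hyps old new by simp
  also have "\<dots> \<le> 2 ^ card Z * (\<Sum>A\<in>Pow Z. (d A)\<^sup>2) + 2 ^ card Z * (\<Sum>A\<in>Pow Z. (s A)\<^sup>2)"
    using sum_squared_le_sum_of_squares[of d "Pow Z"] insert.hyps
    by (intro add_mono insert.IH) (simp add: card_Pow mult.commute)
  also have "\<dots> = 2 ^ card Z * (\<Sum>A\<in>Pow Z. 2 * ((h A)\<^sup>2 + (h (insert w A))\<^sup>2))"
    \<comment> \<open>the parallelogram law, term by term\<close>
    unfolding distrib_left[symmetric] sum.distrib[symmetric]
    by (intro arg_cong2[where f = times] sum.cong refl)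
       (simp add: s_def d_def power2_eq_square algebra_simps)
  also have "\<dots> = 2 ^ card (insert w Z) * (\<Sum>A\<in>Pow (insert w Z). (h A)\<^sup>2)"
    using insert.hyps sum_Pow_insert[of Z w "\<lambda>A. (h A)\<^sup>2"]
    by (simp add: sum_distrib_left mult_ac distrib_left)
  finally show ?case .
qed

text \<open>Here \<open>g x A\<close> stands for a function of the lamplighter's position \<open>x\<close> and of the set \<open>A\<close> of
  lit lamps, and the right-hand side is its Dirichlet energy along moves and along switchings of
  the lamp at the current position. The coefficient at \<open>z\<close> is transported from position \<open>z\<close>, where
  switching is cheap, to position \<open>0\<close>. The first term has a factor \<open>2 * 2 ^ (card Z - 1)\<close>, from the
  Cauchy-Schwarz inequality over the \<open>2 ^ (card Z - 1)\<close> edges in direction \<open>z\<close>. In the second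
  term, Bessel's inequality saves a factor \<open>card Z\<close> over a bound of each coefficient separately,
  and this saving is what makes the theorem work.\<close>

lemma cube_path_inequality:
  fixes g :: "nat \<Rightarrow> nat set \<Rightarrow> real"
  assumes Z: "finite Z" "Z \<subseteq> {..m}"
  shows "(\<Sum>z\<in>Z. (walsh_coeff Z z (g 0))\<^sup>2)
    \<le> 2 ^ card Z * (\<Sum>z\<in>Z. \<Sum>A\<in>Pow (Z - {z}). (g z (insert z A) - g z A)\<^sup>2)
      + 2 * real m * 2 ^ card Z * (\<Sum>x<m. \<Sum>A\<in>Pow Z. (g (Suc x) A - g x A)\<^sup>2)"
proof -
  define \<Delta> where "\<Delta> x A = g (Suc x) A - g x A" for x A
  have one: "(walsh_coeff Z z (g 0))\<^sup>2
      \<le> 2 ^ card Z * (\<Sum>A\<in>Pow (Z - {z}). (g z (insert z A) - g z A)\<^sup>2)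
        + 2 * real m * (\<Sum>x<m. (walsh_coeff Z z (\<Delta> x))\<^sup>2)" if z: "z \<in> Z" for z
  proof -
    have zm: "z \<le> m" using z Z by auto
    have cZ: "card Z = Suc (card (Z - {z}))"
      using card.remove[OF Z(1) z] .
    have "walsh_coeff Z z (\<Delta> x) = walsh_coeff Z z (g (Suc x)) - walsh_coeff Z z (g x)" for x
      unfolding walsh_coeff_diff[symmetric] \<Delta>_def ..
    then have tele: "(\<Sum>x<z. walsh_coeff Z z (\<Delta> x)) = walsh_coeff Z z (g z) - walsh_coeff Z z (g 0)"
      using sum_lessThan_telescope[of "\<lambda>x. walsh_coeff Z z (g x)" z] by simp
    have "(walsh_coeff Z z (g 0))\<^sup>2
        = (walsh_coeff Z z (g z) - (\<Sum>x<z. walsh_coeff Z z (\<Delta> x)))\<^sup>2"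
      using tele by simp
    also have "\<dots> \<le> 2 * (walsh_coeff Z z (g z))\<^sup>2 + 2 * (\<Sum>x<z. walsh_coeff Z z (\<Delta> x))\<^sup>2"
      using zero_le_power2[of "walsh_coeff Z z (g z) + (\<Sum>x<z. walsh_coeff Z z (\<Delta> x))"]
      by (simp add: power2_eq_square algebra_simps)
    also have "(\<Sum>x<z. walsh_coeff Z z (\<Delta> x))\<^sup>2 \<le> real z * (\<Sum>x<z. (walsh_coeff Z z (\<Delta> x))\<^sup>2)"
      using sum_squared_le_sum_of_squares[of _ "{..<z}"] by (simp add: mult.commute)
    also have "\<dots> \<le> real m * (\<Sum>x<m. (walsh_coeff Z z (\<Delta> x))\<^sup>2)"
      using zm by (intro mult_mono sum_mono2) (auto intro: sum_nonneg)
    also have "(walsh_coeff Z z (g z))\<^sup>2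
        \<le> 2 ^ card (Z - {z}) * (\<Sum>A\<in>Pow (Z - {z}). (g z (insert z A) - g z A)\<^sup>2)"
      unfolding walsh_coeff_def
      using sum_squared_le_sum_of_squares[of "\<lambda>A. g z (insert z A) - g z A" "Pow (Z - {z})"] Z
      by (simp add: card_Pow mult.commute)
    finally show ?thesis by (simp add: cZ mult_ac)
  qed
  have "(\<Sum>z\<in>Z. (walsh_coeff Z z (g 0))\<^sup>2)
      \<le> (\<Sum>z\<in>Z. 2 ^ card Z * (\<Sum>A\<in>Pow (Z - {z}). (g z (insert z A) - g z A)\<^sup>2)
        + 2 * real m * (\<Sum>x<m. (walsh_coeff Z z (\<Delta> x))\<^sup>2))"
    by (rule sum_mono) (rule one)
  also have "\<dots> = 2 ^ card Z * (\<Sum>z\<in>Z. \<Sum>A\<in>Pow (Z - {z}). (g z (insert z A) - g z A)\<^sup>2)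
      + 2 * real m * (\<Sum>x<m. \<Sum>z\<in>Z. (walsh_coeff Z z (\<Delta> x))\<^sup>2)"
    using sum.swap[of "\<lambda>z x. (walsh_coeff Z z (\<Delta> x))\<^sup>2" "{..<m}" Z]
    by (simp add: sum.distrib sum_distrib_left[symmetric])
  also have "\<dots> \<le> 2 ^ card Z * (\<Sum>z\<in>Z. \<Sum>A\<in>Pow (Z - {z}). (g z (insert z A) - g z A)\<^sup>2)
      + 2 * real m * (\<Sum>x<m. 2 ^ card Z * (\<Sum>A\<in>Pow Z. (\<Delta> x A)\<^sup>2))"
    by (intro add_left_mono mult_left_mono sum_mono bessel_walsh_coeff Z) simp
  finally show ?thesis
    by (simp add: \<Delta>_def sum_distrib_left[symmetric] mult.assoc)
qed

section \<open>Finitely supported sequences inside \<open>L\<^sub>2([0,1])\<close>\<close>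

text \<open>An orthonormal family, realised by normalised indicators of disjoint dyadic intervals.\<close>

definition bump :: "'i::countable \<Rightarrow> real \<Rightarrow> real" where
  "bump i t = sqrt (2 ^ Suc (to_nat i)) *
     indicator {(1/2) ^ Suc (to_nat i) <.. (1/2) ^ to_nat i} t"

lemma bump_mult_eq_0:
  assumes "i \<noteq> j"
  shows "bump i t * bump j t = 0"
proof -
  have disj: "t \<notin> {(1/2) ^ Suc m <.. (1/2) ^ m} \<or> t \<notin> {(1/2) ^ Suc n <.. (1/2) ^ n}"
    if "m < n" for m n
  proof -
    have "(1/2::real) ^ n \<le> (1/2) ^ Suc m"
      using that by (intro power_decreasing) auto
    then show ?thesis by auto
  qed
  have "to_nat i \<noteq> to_nat j" using assms by simp
  then show ?thesis
    using disj[of "to_nat i" "to_nat j"] disj[of "to_nat j" "to_nat i"]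
    unfolding bump_def by (fastforce simp: neq_iff indicator_def simp del: power_Suc)
qed

lemma bump_measurable [measurable]: "bump i \<in> borel_measurable (lebesgue_on {0..1})"
  unfolding bump_def
  by (intro borel_measurable_times borel_measurable_const measurable_restrict_space1
      borel_measurable_indicator) simp

lemma has_bochner_integral_bump_square:
  "has_bochner_integral (lebesgue_on {0..1}) (\<lambda>t. (bump i t)\<^sup>2) 1"
proof -
  define n where "n = to_nat i"
  define I where "I = {(1/2::real) ^ Suc n <.. (1/2) ^ n}"
  have I: "I \<subseteq> {0..1}"
  proof
    fix t assume "t \<in> I"
    then have "(1/2) ^ Suc n < t" "t \<le> (1/2) ^ n" by (auto simp: I_def)
    moreover have "(0::real) < (1/2) ^ Suc n" "(1/2::real) ^ n \<le> 1"
      by (simp_all add: power_le_one)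
    ultimately have "0 \<le> t" "t \<le> 1" by linarith+
    then show "t \<in> {0..1}" by simp
  qed
  have meas: "I \<in> sets (lebesgue_on {0..1})"
    using I by (subst sets_restrict_space_iff) (auto simp: I_def)
  have em: "emeasure (lebesgue_on {0..1}) I = ennreal ((1/2) ^ Suc n)"
    using I by (subst emeasure_restrict_space) (auto simp: I_def)
  have "has_bochner_integral (lebesgue_on {0..1}) (\<lambda>t. 2 ^ Suc n * indicator I t)
      (2 ^ Suc n * measure (lebesgue_on {0..1}) I)"
    using meas em by (intro has_bochner_integral_mult_right has_bochner_integral_real_indicator) auto
  moreover have "2 ^ Suc n * measure (lebesgue_on {0..1}) I = 1"
    unfolding measure_def em by (simp add: power_divide)
  moreover have "(bump i t)\<^sup>2 = 2 ^ Suc n * indicator I t" for t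
    by (auto simp: bump_def n_def I_def indicator_def power_mult_distrib)
  ultimately show ?thesis by simp
qed

text \<open>The sum runs over the support, so \<open>a\<close> is meant to be finitely supported.\<close>

definition combination :: "('i::countable \<Rightarrow> real) \<Rightarrow> real \<Rightarrow> real" where
  "combination a t = (\<Sum>i | a i \<noteq> 0. a i * bump i t)"

lemma combination_eq:
  assumes "finite B" "{i. a i \<noteq> 0} \<subseteq> B"
  shows "combination a t = (\<Sum>i\<in>B. a i * bump i t)"
  unfolding combination_def using assms by (intro sum.mono_neutral_left) auto

lemma combination_diff:
  assumes "finite {i. a i \<noteq> 0}" "finite {i. b i \<noteq> 0}"
  shows "combination a t - combination b t = combination (\<lambda>i. a i - b i) t"
proof -
  define B where "B = {i. a i \<noteq> 0} \<union> {i. b i \<noteq> 0}"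
  have B: "finite B" "{i. a i \<noteq> 0} \<subseteq> B" "{i. b i \<noteq> 0} \<subseteq> B" "{i. a i - b i \<noteq> 0} \<subseteq> B"
    using assms by (auto simp: B_def)
  show ?thesis
    using B by (simp add: combination_eq[of B] sum_subtractf algebra_simps)
qed

lemma has_bochner_integral_combination_square:
  assumes "finite B" "{i. a i \<noteq> 0} \<subseteq> B"
  shows "has_bochner_integral (lebesgue_on {0..1}) (\<lambda>t. (combination a t)\<^sup>2) (\<Sum>i\<in>B. (a i)\<^sup>2)"
proof -
  have "(combination a t)\<^sup>2 = (\<Sum>i\<in>B. (a i)\<^sup>2 * (bump i t)\<^sup>2)" for t
  proof -
    have "(combination a t)\<^sup>2 = (\<Sum>i\<in>B. \<Sum>j\<in>B. (a i * a j) * (bump i t * bump j t))"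
      using assms by (simp add: combination_eq[of B] power2_eq_square sum_product mult_ac)
    also have "\<dots> = (\<Sum>i\<in>B. \<Sum>j\<in>B. if j = i then (a i)\<^sup>2 * (bump i t)\<^sup>2 else 0)"
      by (intro sum.cong refl) (auto simp: bump_mult_eq_0 power2_eq_square)
    finally show ?thesis using assms by simp
  qed
  moreover have "has_bochner_integral (lebesgue_on {0..1})
      (\<lambda>t. \<Sum>i\<in>B. (a i)\<^sup>2 * (bump i t)\<^sup>2) (\<Sum>i\<in>B. (a i)\<^sup>2 * 1)"
    by (intro has_bochner_integral_sum has_bochner_integral_mult_right
        has_bochner_integral_bump_square)
  ultimately show ?thesis by simp
qed

lemma square_integrable_combination:
  assumes "finite {i. a i \<noteq> 0}"
  shows "square_integrable (combination a)"
proof -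
  have "combination a \<in> borel_measurable (lebesgue_on {0..1})"
    unfolding combination_def by measurable
  then show ?thesis
    using has_bochner_integral_combination_square[OF assms order_refl]
    by (auto simp: square_integrable_def has_bochner_integral_iff)
qed

section \<open>The Lipschitz map on the zero section\<close>

text \<open>Subtracting \<open>of_bool (j < 0)\<close> makes the support finite, also for negative lamps. It cancels in
  differences, where \<open>of_bool (j < a) - of_bool (j < b)\<close> is \<open>\<plusminus>1\<close> for exactly \<open>\<bar>a - b\<bar>\<close> values of
  \<open>j\<close>. The staircase thus places the integers in a Hilbert space with the square root of their
  usual distance.\<close>

definition staircase :: "zwrz \<Rightarrow> int \<times> int \<Rightarrow> real" where
  "staircase g = (\<lambda>(z, j). sqrt \<bar>real_of_int z\<bar> * (of_bool (j < lamps g z) - of_bool (j < 0)))"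

text \<open>A concrete function, not a class modulo null sets, so that identities between increments can be
  used at every point \<open>t\<close>.\<close>

definition profile :: "zwrz \<Rightarrow> real \<Rightarrow> real" where
  "profile g = combination (staircase g)"

lemma finite_staircase: "finite {i. staircase g i \<noteq> 0}"
proof -
  have "{i. staircase g i \<noteq> 0}
      \<subseteq> (SIGMA z:{z. lamps g z \<noteq> 0}. {min 0 (lamps g z)..<max 0 (lamps g z)})"
    by (auto simp: staircase_def of_bool_def split: if_splits)
  then show ?thesis
    by (rule finite_subset) (intro finite_SigmaI finite_lamps finite_atLeastLessThan_int)
qed

lemma profile_diff: "profile g t - profile h t = combination (\<lambda>i. staircase g i - staircase h i) t"
  unfolding profile_def by (intro combination_diff finite_staircase)

lemma square_integrable_profile: "square_integrable (profile g)"
  unfolding profile_def by (intro square_integrable_combination finite_staircase)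

lemma integral_profile_diff_square:
  assumes U: "finite U" "\<And>z. z \<notin> U \<Longrightarrow> lamps g z = lamps h z"
  shows "(LINT t|lebesgue_on {0..1}. (profile g t - profile h t)\<^sup>2)
    = real_of_int (\<Sum>z\<in>U. \<bar>z\<bar> * \<bar>lamps g z - lamps h z\<bar>)"
proof -
  define J where "J z = {min (lamps g z) (lamps h z)..<max (lamps g z) (lamps h z)}" for z
  define B where "B = Sigma U J"
  have fin: "finite B" using U by (auto simp: B_def J_def)
  have sub: "{i. staircase g i - staircase h i \<noteq> 0} \<subseteq> B"
  proof clarify
    fix z j assume ne: "staircase g (z, j) - staircase h (z, j) \<noteq> 0"
    then have "j \<in> J z"
      by (auto simp: staircase_def J_def of_bool_def split: if_splits)
    moreover from this have "z \<in> U" using U(2)[of z] by (cases "z \<in> U") (auto simp: J_def)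
    ultimately show "(z, j) \<in> B" by (simp add: B_def)
  qed
  have sq: "(staircase g (z, j) - staircase h (z, j))\<^sup>2 = \<bar>real_of_int z\<bar>" if "j \<in> J z" for z j
    using that by (auto simp: staircase_def J_def of_bool_def split: if_splits)
  have "(LINT t|lebesgue_on {0..1}. (profile g t - profile h t)\<^sup>2)
      = (\<Sum>i\<in>B. (staircase g i - staircase h i)\<^sup>2)"
    unfolding profile_diff
    by (rule has_bochner_integral_integral_eq[OF has_bochner_integral_combination_square[OF fin sub]])
  also have "\<dots> = (\<Sum>z\<in>U. \<Sum>j\<in>J z. (staircase g (z, j) - staircase h (z, j))\<^sup>2)"
    unfolding B_def using U by (subst sum.Sigma) (auto simp: J_def)
  also have "\<dots> = (\<Sum>z\<in>U. \<Sum>j\<in>J z. \<bar>real_of_int z\<bar>)"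
    by (intro sum.cong refl sq)
  also have "\<dots> = real_of_int (\<Sum>z\<in>U. \<bar>z\<bar> * \<bar>lamps g z - lamps h z\<bar>)"
    by (auto simp: J_def intro!: sum.cong)
  finally show ?thesis .
qed

text \<open>Both bounds are stated for an arbitrary \<open>B\<close> and \<open>z\<close> because prefixing a shift to the word
  translates the lamps.\<close>

lemma lamps_sum_list_bounds:
  assumes "set ws \<subseteq> generators"
  shows "(finite B \<longrightarrow> (\<Sum>z\<in>B. \<bar>lamps (sum_list ws) z\<bar>) \<le> int (length ws)) \<and>
    (lamps (sum_list ws) z \<noteq> 0 \<longrightarrow> \<bar>z\<bar> \<le> int (length ws))"
  using assms
proof (induction ws arbitrary: B z)
  case Nil
  then show ?case by simp
next
  case (Cons a ws)
  let ?h = "sum_list ws"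
  have IH1: "(\<Sum>z\<in>B. \<bar>lamps ?h z\<bar>) \<le> int (length ws)" if "finite B" for B
    using Cons that by simp
  have IH2: "\<bar>z\<bar> \<le> int (length ws)" if "lamps ?h z \<noteq> 0" for z
    using Cons that by simp
  from Cons.prems consider s where "a = shift s" "\<bar>s\<bar> = 1" | e where "a = lamp e" "\<bar>e\<bar> = 1"
    by (auto simp: generators_def)
  then show ?case
  proof cases
    case 1
    have "(\<Sum>z\<in>B. \<bar>lamps ?h (z - s)\<bar>) = (\<Sum>z\<in>(\<lambda>z. z - s) ` B. \<bar>lamps ?h z\<bar>)"
      by (subst sum.reindex) (auto simp: inj_on_def)
    then show ?thesis
      using 1 IH1[of "(\<lambda>z. z - s) ` B"] IH2[of "z - s"] by auto
  next
    case 2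
    have "(\<Sum>z\<in>B. \<bar>(if z = 0 then e else 0) + lamps ?h z\<bar>)
        \<le> (\<Sum>z\<in>B. (if z = 0 then 1 else 0) + \<bar>lamps ?h z\<bar>)"
      using 2 by (intro sum_mono) auto
    then have "(\<Sum>z\<in>B. \<bar>(if z = 0 then e else 0) + lamps ?h z\<bar>) \<le> 1 + int (length ws)"
      if "finite B"
      using that IH1[OF that] by (cases "0 \<in> B") (auto simp: sum.distrib)
    then show ?thesis
      using 2 IH2[of z] by auto
  qed
qed

lemma sum_lamps_le_word_length_square:
  assumes "finite B"
  shows "(\<Sum>z\<in>B. \<bar>z\<bar> * \<bar>lamps g z\<bar>) \<le> (int (word_length g))\<^sup>2"
proof -
  obtain ws where ws: "set ws \<subseteq> generators" "length ws = word_length g" "sum_list ws = g"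
    using word_length_word by blast
  have "(\<Sum>z\<in>B. \<bar>z\<bar> * \<bar>lamps g z\<bar>) \<le> (\<Sum>z\<in>B. int (word_length g) * \<bar>lamps g z\<bar>)"
  proof (rule sum_mono)
    fix z
    show "\<bar>z\<bar> * \<bar>lamps g z\<bar> \<le> int (word_length g) * \<bar>lamps g z\<bar>"
      using lamps_sum_list_bounds[OF ws(1), of B z] ws
      by (cases "lamps g z = 0") (auto intro: mult_right_mono)
  qed
  also have "\<dots> \<le> int (word_length g) * int (word_length g)"
    unfolding sum_distrib_left[symmetric]
    using lamps_sum_list_bounds[OF ws(1), of B 0] ws assms by (intro mult_left_mono) auto
  finally show ?thesis by (simp add: power2_eq_square)
qed

definition staircase_map :: "zwrz \<Rightarrow> L2" where
  "staircase_map g = abs_L2 (profile g)"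

lemma dist_abs_L2_square:
  assumes "square_integrable f" "square_integrable g"
  shows "(dist (abs_L2 f) (abs_L2 g))\<^sup>2 = (LINT t|lebesgue_on {0..1}. (f t - g t)\<^sup>2)"
  using assms by (subst dist_L2.abs_eq) (auto simp: L2_rel_def)

lemma lipschitz_staircase_map: "1-lipschitz_on zero_section staircase_map"
proof (rule lipschitz_onI)
  fix g h assume gh: "g \<in> zero_section" "h \<in> zero_section"
  define U where "U = {z. lamps g z \<noteq> 0} \<union> {z. lamps h z \<noteq> 0}"
  have U: "finite U" "\<And>z. z \<notin> U \<Longrightarrow> lamps g z = lamps h z"
    using finite_lamps by (auto simp: U_def)
  have "(dist (staircase_map g) (staircase_map h))\<^sup>2
      = real_of_int (\<Sum>z\<in>U. \<bar>z\<bar> * \<bar>lamps g z - lamps h z\<bar>)"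
    unfolding staircase_map_def
    by (simp only: dist_abs_L2_square square_integrable_profile)
       (rule integral_profile_diff_square[OF U])
  also have "(\<Sum>z\<in>U. \<bar>z\<bar> * \<bar>lamps g z - lamps h z\<bar>)
      = (\<Sum>z\<in>U. \<bar>z\<bar> * \<bar>lamps (- g + h) z\<bar>)"
    using gh by (simp add: zero_section_def abs_minus_commute)
  also have "real_of_int \<dots> \<le> real_of_int ((int (word_length (- g + h)))\<^sup>2)"
    unfolding of_int_le_iff by (rule sum_lamps_le_word_length_square[OF U(1)])
  also have "\<dots> = (dist g h)\<^sup>2"
    by (simp add: dist_zwrz_def)
  finally show "dist (staircase_map g) (staircase_map h) \<le> 1 * dist g h"
    by (simp add: power2_le_iff_abs_le)
qed simp

section \<open>Cubes of lamp configurations\<close>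

text \<open>The test \<open>finite A\<close> gives the term a finite support for every set \<open>A\<close>.\<close>

lift_definition lit :: "nat \<Rightarrow> nat set \<Rightarrow> nat \<Rightarrow> zwrz"
  is "\<lambda>k A x. (\<lambda>z. if finite A \<and> z \<in> int ` A then int k else 0, int x)"
proof -
  fix k x :: nat and A :: "nat set"
  have "finite {z. (if finite A \<and> z \<in> int ` A then int k else 0) \<noteq> 0}"
    by (cases "finite A") (auto intro: finite_subset[of _ "int ` A"])
  then show "(\<lambda>z. if finite A \<and> z \<in> int ` A then int k else 0, int x) \<in> {(f, x). finite {z. f z \<noteq> 0}}"
    by simp
qed

lemma pos_lit [simp]: "pos (lit k A x) = int x"
  by transfer simp

lemma lamps_lit [simp]: "finite A \<Longrightarrow> lamps (lit k A x) z = (if z \<in> int ` A then int k else 0)"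
  by transfer simp

lemma dist_lit_move:
  assumes "finite A"
  shows "dist (lit k A (Suc x)) (lit k A x) \<le> 1"
proof -
  have "- lit k A (Suc x) + lit k A x = sum_list [shift (- 1)]"
    using assms by (intro zwrz_eqI ext; simp add: algebra_simps)
  then show ?thesis
    using word_length_le[of "[shift (- 1)]"] by (simp add: dist_zwrz_def generators_def)
qed

lemma dist_lit_switch:
  assumes "finite A" "x \<notin> A"
  shows "dist (lit k (insert x A) x) (lit k A x) \<le> real k"
proof -
  have "sum_list (replicate k (lamp (- 1))) = lamp (- int k)"
    by (induction k) (auto intro!: zwrz_eqI)
  moreover have "- lit k (insert x A) x + lit k A x = lamp (- int k)"
    using assms by (intro zwrz_eqI ext; auto)
  moreover have "set (replicate k (lamp (- 1))) \<subseteq> generators"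
    by (auto simp: generators_def)
  ultimately show ?thesis
    using word_length_le[of "replicate k (lamp (- 1))"] by (simp add: dist_zwrz_def)
qed

text \<open>A lamp contributes to the profile independently of the others, so the increment caused by
  one lamp is the same as if all others were off. Averaging over the other lamps therefore loses
  nothing on the zero section.\<close>

lemma profile_lit_insert:
  assumes "finite A" "z \<notin> A"
  shows "profile (lit k (insert z A) 0) t - profile (lit k A 0) t
    = profile (lit k {z} 0) t - profile (lit k {} 0) t"
  unfolding profile_diff
  using assms by (intro arg_cong[where f = "\<lambda>a. combination a t"] ext) (auto simp: staircase_def)

lemma no_lipschitz_extension:
  fixes G :: "zwrz \<Rightarrow> L2"
  assumes lip: "C-lipschitz_on UNIV G" and ext: "\<And>g. g \<in> zero_section \<Longrightarrow> G g = staircase_map g"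
  shows False
proof -
  \<comment> \<open>Representatives of the values of \<open>G\<close>, chosen to be the profiles themselves on the zero section,
      where additivity in the lamps is needed pointwise.\<close>
  have "\<exists>f. square_integrable f \<and> abs_L2 f = G g \<and> (g \<in> zero_section \<longrightarrow> f = profile g)" for g
  proof (cases "g \<in> zero_section")
    case True
    then show ?thesis using ext square_integrable_profile by (auto simp: staircase_map_def)
  next
    case False
    have "L2_rel (rep_L2 (G g)) (rep_L2 (G g))" "abs_L2 (rep_L2 (G g)) = G g"
      using Quotient3_rep_reflp[OF Quotient3_L2] Quotient3_abs_rep[OF Quotient3_L2] by auto
    then show ?thesis using False by (auto simp: L2_rel_def)
  qed
  then obtain r where r: "\<And>g. square_integrable (r g)" "\<And>g. abs_L2 (r g) = G g"
    "\<And>g. g \<in> zero_section \<Longrightarrow> r g = profile g"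
    by metis
  \<comment> \<open>The constant \<open>20 = 4 + 16\<close> collects the two terms of the final estimate, which are of the same
      order precisely for \<open>m = k\<^sup>2\<close>.\<close>
  obtain k :: nat where k: "20 * C\<^sup>2 < real k" "0 < k"
    using reals_Archimedean2[of "20 * C\<^sup>2"]
    by (metis gr0I not_less of_nat_0 zero_le_mult_iff zero_le_numeral zero_le_power2)
  define m where "m = k\<^sup>2"
  define Z where "Z = {1..m}"
  define N where "N = (2::real) ^ m"
  have cZ: "finite Z" "card Z = m" by (auto simp: Z_def)
  have fin: "finite A" if "A \<subseteq> Z" for A using that cZ finite_subset by blast
  have one_Z: "1 \<in> Z" using k by (simp add: Z_def m_def)
  have N: "N > 0" by (simp add: N_def)
  have half: "real (card (Pow (Z - {z}))) = N / 2" if z: "z \<in> Z" for z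
  proof -
    have "m = Suc (card (Z - {z}))" using z cZ by (metis card.remove)
    then show ?thesis using cZ by (simp add: card_Pow N_def)
  qed
  have N_pred: "2 * 2 ^ (m - Suc 0) = N"
    using half[OF one_Z] one_Z cZ by (simp add: card_Pow)
  define g where "g t x A = r (lit k A x) t" for t x A
  define D where "D z t = profile (lit k {z} 0) t - profile (lit k {} 0) t" for z t
  have zs: "lit k A 0 \<in> zero_section" for A by (simp add: zero_section_def)
  have g0: "walsh_coeff Z z (g t 0) = N / 2 * D z t" if z: "z \<in> Z" for z t
  proof -
    have "walsh_coeff Z z (g t 0) = (\<Sum>A\<in>Pow (Z - {z}). D z t)"
      unfolding walsh_coeff_def g_def D_def
      using fin by (intro sum.cong refl) (auto simp: r(3)[OF zs] intro!: profile_lit_insert)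
    then show ?thesis using half[OF z] by simp
  qed
  let ?M = "lebesgue_on {0..1::real}"
  have sq: "integrable ?M (\<lambda>t. (g t x A - g t y B)\<^sup>2)" for x A y B
    using square_integrable_diff[OF r(1) r(1)] by (simp add: g_def square_integrable_def)
  have le: "(LINT t|?M. (g t x A - g t y B)\<^sup>2) \<le> (C * b)\<^sup>2"
    if "dist (lit k A x) (lit k B y) \<le> b" for x A y B b
  proof -
    have "(LINT t|?M. (g t x A - g t y B)\<^sup>2) = (dist (G (lit k A x)) (G (lit k B y)))\<^sup>2"
      unfolding g_def by (metis dist_abs_L2_square r(1,2))
    also have "\<dots> \<le> (C * b)\<^sup>2"
    proof (rule power_mono)
      have "dist (G (lit k A x)) (G (lit k B y)) \<le> C * dist (lit k A x) (lit k B y)"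
        using lip by (auto dest: lipschitz_onD)
      also have "\<dots> \<le> C * b"
        using that lipschitz_on_nonneg[OF lip] by (rule mult_left_mono)
      finally show "dist (G (lit k A x)) (G (lit k B y)) \<le> C * b" .
    qed simp
    finally show ?thesis .
  qed
  have D_sq: "integrable ?M (\<lambda>t. (D z t)\<^sup>2)" "(LINT t|?M. (D z t)\<^sup>2) = real z * real k" for z
  proof -
    show "integrable ?M (\<lambda>t. (D z t)\<^sup>2)"
      using square_integrable_diff[OF square_integrable_profile square_integrable_profile]
      by (simp add: D_def square_integrable_def)
    show "(LINT t|?M. (D z t)\<^sup>2) = real z * real k"
      unfolding D_def by (subst integral_profile_diff_square[of "{int z}"]) auto
  qed
  have pointwise: "(N / 2)\<^sup>2 * (\<Sum>z\<in>Z. (D z t)\<^sup>2)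
      \<le> N * (\<Sum>z\<in>Z. \<Sum>A\<in>Pow (Z - {z}). (g t z (insert z A) - g t z A)\<^sup>2)
        + 2 * real m * N * (\<Sum>x<m. \<Sum>A\<in>Pow Z. (g t (Suc x) A - g t x A)\<^sup>2)" for t
  proof -
    have "(N / 2)\<^sup>2 * (\<Sum>z\<in>Z. (D z t)\<^sup>2) = (\<Sum>z\<in>Z. (walsh_coeff Z z (g t 0))\<^sup>2)"
      unfolding sum_distrib_left by (intro sum.cong refl) (simp add: g0 power_mult_distrib power_divide)
    then show ?thesis
      using cube_path_inequality[of Z m "g t"] cZ by (simp add: N_def Z_def)
  qed
  have "(N / 2)\<^sup>2 * (\<Sum>z\<in>Z. real z * real k)
      = (LINT t|?M. (N / 2)\<^sup>2 * (\<Sum>z\<in>Z. (D z t)\<^sup>2))"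
    using D_sq by simp
  also have "\<dots> \<le> (LINT t|?M. N * (\<Sum>z\<in>Z. \<Sum>A\<in>Pow (Z - {z}). (g t z (insert z A) - g t z A)\<^sup>2)
        + 2 * real m * N * (\<Sum>x<m. \<Sum>A\<in>Pow Z. (g t (Suc x) A - g t x A)\<^sup>2))"
    by (rule integral_mono[OF _ _ pointwise]) (simp_all add: D_sq sq)
  also have "\<dots> = N * (\<Sum>z\<in>Z. \<Sum>A\<in>Pow (Z - {z}). (LINT t|?M. (g t z (insert z A) - g t z A)\<^sup>2))
        + 2 * real m * N * (\<Sum>x<m. \<Sum>A\<in>Pow Z. (LINT t|?M. (g t (Suc x) A - g t x A)\<^sup>2))"
    using sq by simp
  also have "\<dots> \<le> N * (\<Sum>z\<in>Z. \<Sum>A\<in>Pow (Z - {z}). (C * real k)\<^sup>2)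
        + 2 * real m * N * (\<Sum>x<m. \<Sum>A\<in>Pow Z. (C * 1)\<^sup>2)"
    using N fin
    by (intro add_mono mult_left_mono sum_mono le dist_lit_switch dist_lit_move) auto
  also have "\<dots> = N\<^sup>2 * (real m * C\<^sup>2 * (real k)\<^sup>2 / 2 + 2 * (real m)\<^sup>2 * C\<^sup>2)"
    using N_pred cZ by (simp add: card_Pow N_def[symmetric] power2_eq_square algebra_simps)
  finally have "(\<Sum>z\<in>Z. real z * real k) / 4 \<le> real m * C\<^sup>2 * (real k)\<^sup>2 / 2 + 2 * (real m)\<^sup>2 * C\<^sup>2"
    using N by (simp add: power_divide)
  moreover have "real m * real m / 2 * real k \<le> (\<Sum>z\<in>Z. real z * real k)"
  proof -
    have "2 * (\<Sum>z\<in>Z. real z) = real m * (real m + 1)"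
      unfolding Z_def by (induction m) (auto simp: algebra_simps)
    then have "real m * real m / 2 \<le> (\<Sum>z\<in>Z. real z)"
      by (simp add: algebra_simps)
    then show ?thesis
      unfolding sum_distrib_right[symmetric] by (rule mult_right_mono) simp
  qed
  ultimately have "real m * real m * real k \<le> 4 * real m * C\<^sup>2 * (real k)\<^sup>2 + 16 * (real m)\<^sup>2 * C\<^sup>2"
    by (simp add: algebra_simps power2_eq_square)
  then have "(real m)\<^sup>2 * real k \<le> (real m)\<^sup>2 * (20 * C\<^sup>2)"
    by (simp add: m_def algebra_simps power2_eq_square)
  then show False
    using k by (simp add: m_def)
qed

theorem theorem8p1:
  shows "\<exists>F :: zwrz \<Rightarrow> L2.
    (\<exists>C. C-lipschitz_on zero_section F) \<and>
    \<not> (\<exists>G :: zwrz \<Rightarrow> L2. (\<exists>C. C-lipschitz_on UNIV G) \<and> (\<forall>g\<in>zero_section. G g = F g))"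
  using lipschitz_staircase_map no_lipschitz_extension by blast

end
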